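(* For $k\ge 1$, let $C_k$ denote the number of bisymmetric quasitrivial nondecreasing binary operations $F:L_k^2\to L_k$, and let $D_k$ denote the number of bisymmetric quasitrivial nondecreasing binary operations $F:L_k^2\to L_k$ having a neutral element. Then $$D_k=2^{k-1},\qquad C_k=3\cdot 2^{k-1}-2.$$
   Context: $L_k=\{1,\dots,k\}$ with the natural order. An operation $F:L_k^2\to L_k$ is quasitrivial if $F(x,y)\in\{x,y\}$ for all $x,y$; bisymmetric if $F(F(u,v),F(w,z))=F(F(u,w),F(v,z))$ for all $u,v,w,z\in L_k$; nondecreasing if $F(x,y)\le F(x',y')$ whenever $x\le x'$ and $y\le y'$. An element $e$ is a neutral element of $F$ if $F(e,x)=F(x,e)=x$ for all $x\in L_k$. *)

theory Defs
  imports Main "HOL-Library.FuncSet"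
begin

definition L :: "nat \<Rightarrow> nat set" where
  "L k = {1..k}"

text \<open>The extensional function space \<open>\<rightarrow>\<^sub>E\<close> (value \<open>undefined\<close> outside the domain) makes
  distinct functions on \<open>nat \<times> nat\<close> represent distinct operations on \<open>L k\<close>, so that cardinalities
  of sets of operations are the intended ones.\<close>

definition binary_ops :: "nat \<Rightarrow> (nat \<times> nat \<Rightarrow> nat) set" where
  "binary_ops k = (L k \<times> L k) \<rightarrow>\<^sub>E L k"

definition quasitrivial :: "nat \<Rightarrow> (nat \<times> nat \<Rightarrow> nat) \<Rightarrow> bool" where
  "quasitrivial k F \<longleftrightarrow> (\<forall>x\<in>L k. \<forall>y\<in>L k. F (x, y) \<in> {x, y})"

definition bisymmetric :: "nat \<Rightarrow> (nat \<times> nat \<Rightarrow> nat) \<Rightarrow> bool" where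
  "bisymmetric k F \<longleftrightarrow> (\<forall>u\<in>L k. \<forall>v\<in>L k. \<forall>w\<in>L k. \<forall>z\<in>L k.
     F (F (u, v), F (w, z)) = F (F (u, w), F (v, z)))"

definition nondecreasing :: "nat \<Rightarrow> (nat \<times> nat \<Rightarrow> nat) \<Rightarrow> bool" where
  "nondecreasing k F \<longleftrightarrow> (\<forall>x\<in>L k. \<forall>y\<in>L k. \<forall>x'\<in>L k. \<forall>y'\<in>L k.
     x \<le> x' \<longrightarrow> y \<le> y' \<longrightarrow> F (x, y) \<le> F (x', y'))"

definition neutral_element :: "nat \<Rightarrow> (nat \<times> nat \<Rightarrow> nat) \<Rightarrow> nat \<Rightarrow> bool" where
  "neutral_element k F e \<longleftrightarrow> e \<in> L k \<and> (\<forall>x\<in>L k. F (e, x) = x \<and> F (x, e) = x)"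

definition C :: "nat \<Rightarrow> nat" where
  "C k = card {F \<in> binary_ops k. bisymmetric k F \<and> quasitrivial k F \<and> nondecreasing k F}"

definition D :: "nat \<Rightarrow> nat" where
  "D k = card {F \<in> binary_ops k. bisymmetric k F \<and> quasitrivial k F \<and> nondecreasing k F \<and>
     (\<exists>e. neutral_element k F e)}"

end

theory Submission
  imports Defs
begin

text \<open>Let \<open>m\<close> and \<open>M\<close> be the least and the greatest element of a chain with at least two elements.
  If \<open>F (m, M) = F (M, m)\<close>, then monotonicity makes this common value an annihilator, and \<open>F\<close> is
  determined by its restriction to the remaining elements, which is an arbitrary operation of the
  same kind. If \<open>F (m, M) \<noteq> F (M, m)\<close>, then bisymmetry forces \<open>F\<close> to be one of the two
  projections. Hence \<open>c (n + 1) = 2 c n + 2\<close>, and, since the projections have no neutral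
  element while adjoining an annihilator preserves one, \<open>d (n + 1) = 2 d n\<close>.\<close>

section \<open>Operations on an arbitrary chain\<close>

text \<open>The carrier is any subset of a linear order, because the induction removes the least or
  the greatest element and so leaves the family of initial segments \<open>L k\<close>.\<close>

definition bqn_ops :: "'a::linorder set \<Rightarrow> ('a \<times> 'a \<Rightarrow> 'a) set" where
  "bqn_ops A = {F \<in> A \<times> A \<rightarrow>\<^sub>E A.
     (\<forall>u\<in>A. \<forall>v\<in>A. \<forall>w\<in>A. \<forall>z\<in>A. F (F (u, v), F (w, z)) = F (F (u, w), F (v, z))) \<and>
     (\<forall>x\<in>A. \<forall>y\<in>A. F (x, y) \<in> {x, y}) \<and>
     (\<forall>x\<in>A. \<forall>y\<in>A. \<forall>x'\<in>A. \<forall>y'\<in>A. x \<le> x' \<longrightarrow> y \<le> y' \<longrightarrow> F (x, y) \<le> F (x', y'))}"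

definition has_neutral :: "'a set \<Rightarrow> ('a \<times> 'a \<Rightarrow> 'a) \<Rightarrow> bool" where
  "has_neutral A F \<longleftrightarrow> (\<exists>e\<in>A. \<forall>x\<in>A. F (e, x) = x \<and> F (x, e) = x)"

definition annihilator :: "'a set \<Rightarrow> ('a \<times> 'a \<Rightarrow> 'a) \<Rightarrow> 'a \<Rightarrow> bool" where
  "annihilator A F m \<longleftrightarrow> (\<forall>x\<in>A. F (m, x) = m \<and> F (x, m) = m)"

text \<open>The restricted abstraction keeps the result extensional on the larger square, as
  membership in \<open>bqn_ops\<close> demands.\<close>

definition adjoin :: "'a \<Rightarrow> 'a set \<Rightarrow> ('a \<times> 'a \<Rightarrow> 'a) \<Rightarrow> 'a \<times> 'a \<Rightarrow> 'a" where
  "adjoin m B G = (\<lambda>p\<in>insert m B \<times> insert m B. if p \<in> B \<times> B then G p else m)"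

lemma bqn_opsD:
  assumes "F \<in> bqn_ops A"
  shows "F \<in> A \<times> A \<rightarrow>\<^sub>E A"
    and "\<lbrakk>x \<in> A; y \<in> A\<rbrakk> \<Longrightarrow> F (x, y) \<in> A"
    and "\<lbrakk>u \<in> A; v \<in> A; w \<in> A; z \<in> A\<rbrakk> \<Longrightarrow> F (F (u, v), F (w, z)) = F (F (u, w), F (v, z))"
    and "\<lbrakk>x \<in> A; y \<in> A\<rbrakk> \<Longrightarrow> F (x, y) = x \<or> F (x, y) = y"
    and "\<lbrakk>x \<in> A; y \<in> A; x' \<in> A; y' \<in> A; x \<le> x'; y \<le> y'\<rbrakk> \<Longrightarrow> F (x, y) \<le> F (x', y')"
proof -
  show PiE: "F \<in> A \<times> A \<rightarrow>\<^sub>E A"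
    using assms by (simp add: bqn_ops_def)
  show "F (x, y) \<in> A" if "x \<in> A" "y \<in> A"
    using PiE_mem[OF PiE, of "(x, y)"] that by simp
qed (use assms in \<open>simp_all add: bqn_ops_def\<close>)

lemma bqn_opsI:
  assumes "F \<in> extensional (A \<times> A)"
    and "\<And>u v w z. \<lbrakk>u \<in> A; v \<in> A; w \<in> A; z \<in> A\<rbrakk> \<Longrightarrow>
      F (F (u, v), F (w, z)) = F (F (u, w), F (v, z))"
    and "\<And>x y. \<lbrakk>x \<in> A; y \<in> A\<rbrakk> \<Longrightarrow> F (x, y) = x \<or> F (x, y) = y"
    and "\<And>x y x' y'. \<lbrakk>x \<in> A; y \<in> A; x' \<in> A; y' \<in> A; x \<le> x'; y \<le> y'\<rbrakk> \<Longrightarrow>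
      F (x, y) \<le> F (x', y')"
  shows "F \<in> bqn_ops A"
proof -
  have "F (x, y) \<in> A" if "x \<in> A" "y \<in> A" for x y
    using assms(3)[OF that] that by auto
  then have "F \<in> A \<times> A \<rightarrow>\<^sub>E A"
    using assms(1) by (auto simp: PiE_def)
  then show ?thesis
    using assms(2-4) by (simp add: bqn_ops_def)
qed

lemma finite_bqn_ops:
  assumes "finite A"
  shows "finite (bqn_ops A)"
proof (rule finite_subset)
  show "bqn_ops A \<subseteq> A \<times> A \<rightarrow>\<^sub>E A"
    by (intro subsetI bqn_opsD(1))
  show "finite (A \<times> A \<rightarrow>\<^sub>E A)"
    using assms by (intro finite_PiE) auto
qed

section \<open>Adjoining an extreme element as annihilator\<close>

lemma adjoin_simps:
  assumes "m \<notin> B"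
  shows "\<lbrakk>x \<in> B; y \<in> B\<rbrakk> \<Longrightarrow> adjoin m B G (x, y) = G (x, y)"
    and "y \<in> insert m B \<Longrightarrow> adjoin m B G (m, y) = m"
    and "x \<in> insert m B \<Longrightarrow> adjoin m B G (x, m) = m"
  using assms by (auto simp: adjoin_def)

lemma annihilator_adjoin:
  assumes "m \<notin> B"
  shows "annihilator (insert m B) (adjoin m B G) m"
  using assms by (auto simp: annihilator_def adjoin_simps)

text \<open>If \<open>m\<close> occurs among the four arguments, both sides of bisymmetry collapse
  to \<open>m\<close>; otherwise the law is that of \<open>G\<close>. For monotonicity with
  \<open>m\<close> least, an \<open>m\<close> in the smaller pair gives the value \<open>m\<close>,
  which is below everything; without one, both pairs lie in \<open>B\<close>. The greatest case is
  dual, with the larger pair.\<close>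

lemma adjoin_in_bqn_ops:
  assumes "m \<notin> B" and extreme: "(\<forall>x\<in>B. m < x) \<or> (\<forall>x\<in>B. x < m)" and G: "G \<in> bqn_ops B"
  shows "adjoin m B G \<in> bqn_ops (insert m B)"
proof (rule bqn_opsI)
  note [simp] = adjoin_simps[OF assms(1)]
  let ?F = "adjoin m B G"
  have closed: "G (x, y) \<in> B" if "x \<in> B" "y \<in> B" for x y
    using bqn_opsD(2)[OF G that] .
  have closed': "?F (x, y) \<in> insert m B" if "x \<in> insert m B" "y \<in> insert m B" for x y
    using that closed by auto
  show "?F \<in> extensional (insert m B \<times> insert m B)"
    by (simp add: adjoin_def)
  show "?F (?F (u, v), ?F (w, z)) = ?F (?F (u, w), ?F (v, z))"
    if mem: "u \<in> insert m B" "v \<in> insert m B" "w \<in> insert m B" "z \<in> insert m B" for u v w z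
  proof (cases "u = m \<or> v = m \<or> w = m \<or> z = m")
    case True
    then show ?thesis using mem assms(1) by (auto simp: closed)
  next
    case False
    then have "u \<in> B" "v \<in> B" "w \<in> B" "z \<in> B" using mem by auto
    then show ?thesis
      using bqn_opsD(3)[OF G, of u v w z] closed by simp
  qed
  show "?F (x, y) = x \<or> ?F (x, y) = y" if "x \<in> insert m B" "y \<in> insert m B" for x y
    using that bqn_opsD(4)[OF G, of x y] by auto
  show "?F (x, y) \<le> ?F (x', y')"
    if mem: "x \<in> insert m B" "y \<in> insert m B" "x' \<in> insert m B" "y' \<in> insert m B"
      and le: "x \<le> x'" "y \<le> y'" for x y x' y'
    using extreme
  proof
    assume least: "\<forall>x\<in>B. m < x"
    show ?thesis
    proof (cases "x = m \<or> y = m")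
      case True
      then have "?F (x, y) = m" using mem assms(1) by auto
      moreover have "m \<le> ?F (x', y')"
        using closed'[OF mem(3,4)] least by (auto intro: less_imp_le)
      ultimately show ?thesis by simp
    next
      case False
      then have "x \<in> B" "y \<in> B" using mem by simp_all
      moreover have "x' \<noteq> m" "y' \<noteq> m"
        using bspec[OF least \<open>x \<in> B\<close>] bspec[OF least \<open>y \<in> B\<close>] le by auto
      ultimately show ?thesis using bqn_opsD(5)[OF G] mem le by simp
    qed
  next
    assume greatest: "\<forall>x\<in>B. x < m"
    show ?thesis
    proof (cases "x' = m \<or> y' = m")
      case True
      then have "?F (x', y') = m" using mem assms(1) by auto
      moreover have "?F (x, y) \<le> m"
        using closed'[OF mem(1,2)] greatest by (auto intro: less_imp_le)
      ultimately show ?thesis by simp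
    next
      case False
      then have "x' \<in> B" "y' \<in> B" using mem by simp_all
      moreover have "x \<noteq> m" "y \<noteq> m"
        using bspec[OF greatest \<open>x' \<in> B\<close>] bspec[OF greatest \<open>y' \<in> B\<close>] le by auto
      ultimately show ?thesis using bqn_opsD(5)[OF G] mem le by simp
    qed
  qed
qed

text \<open>An annihilator \<open>m\<close> cannot be neutral once some \<open>b\<close> in
  \<open>B\<close> exists, since it sends \<open>b\<close> to \<open>m\<close>. For empty
  \<open>B\<close> the equivalence fails: on a single point \<open>m\<close> is neutral.\<close>

lemma has_neutral_adjoin:
  assumes "m \<notin> B" "B \<noteq> {}"
  shows "has_neutral (insert m B) (adjoin m B G) \<longleftrightarrow> has_neutral B G"
proof
  note [simp] = adjoin_simps[OF assms(1)]
  assume "has_neutral (insert m B) (adjoin m B G)"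
  then obtain e where e: "e \<in> insert m B"
    and neutral: "\<And>x. x \<in> insert m B \<Longrightarrow> adjoin m B G (e, x) = x \<and> adjoin m B G (x, e) = x"
    unfolding has_neutral_def by blast
  obtain b where "b \<in> B" using assms(2) by blast
  then have "e \<noteq> m" using neutral[of b] assms(1) by auto
  then have "e \<in> B" using e by simp
  have "G (e, x) = x \<and> G (x, e) = x" if "x \<in> B" for x
    using neutral[of x] that \<open>e \<in> B\<close> by simp
  then show "has_neutral B G"
    using \<open>e \<in> B\<close> unfolding has_neutral_def by blast
next
  assume "has_neutral B G"
  then show "has_neutral (insert m B) (adjoin m B G)"
    unfolding has_neutral_def by (auto simp: adjoin_simps[OF assms(1)])
qed

lemma inj_on_adjoin:
  assumes "m \<notin> B"
  shows "inj_on (adjoin m B) (bqn_ops B)"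
proof (rule inj_onI)
  fix G H assume G: "G \<in> bqn_ops B" and H: "H \<in> bqn_ops B" and eq: "adjoin m B G = adjoin m B H"
  show "G = H"
  proof (rule PiE_ext[OF bqn_opsD(1)[OF G] bqn_opsD(1)[OF H]])
    fix p assume "p \<in> B \<times> B"
    then show "G p = H p"
      using fun_cong[OF eq, of p] adjoin_simps(1)[OF assms] by auto
  qed
qed

text \<open>The inverse of adjoining is restriction to \<open>B \<times> B\<close>: by
  quasitriviality every subset is closed under \<open>F\<close>, so the restriction is again an
  operation on \<open>B\<close>.\<close>

lemma adjoin_image:
  assumes "m \<notin> B" and "(\<forall>x\<in>B. m < x) \<or> (\<forall>x\<in>B. x < m)"
  shows "adjoin m B ` bqn_ops B = {F \<in> bqn_ops (insert m B). annihilator (insert m B) F m}"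
proof (intro equalityI subsetI)
  fix F assume "F \<in> adjoin m B ` bqn_ops B"
  then show "F \<in> {F \<in> bqn_ops (insert m B). annihilator (insert m B) F m}"
    using adjoin_in_bqn_ops[OF assms] annihilator_adjoin[OF assms(1)] by auto
next
  fix F assume "F \<in> {F \<in> bqn_ops (insert m B). annihilator (insert m B) F m}"
  then have F: "F \<in> bqn_ops (insert m B)" and ann: "annihilator (insert m B) F m"
    by auto
  define G where "G = restrict F (B \<times> B)"
  have G: "G (x, y) = F (x, y)" if "x \<in> B" "y \<in> B" for x y
    using that by (simp add: G_def)
  have closed: "F (x, y) \<in> B" if "x \<in> B" "y \<in> B" for x y
    using bqn_opsD(4)[OF F, of x y] that by auto
  have "G \<in> bqn_ops B"
  proof (rule bqn_opsI)
    show "G \<in> extensional (B \<times> B)" by (simp add: G_def)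
    show "G (G (u, v), G (w, z)) = G (G (u, w), G (v, z))"
      if "u \<in> B" "v \<in> B" "w \<in> B" "z \<in> B" for u v w z
      using that bqn_opsD(3)[OF F, of u v w z] by (simp add: G closed)
  qed (use bqn_opsD(4,5)[OF F] in \<open>simp_all add: G\<close>)
  moreover have "F = adjoin m B G"
  proof (rule extensionalityI[where A = "insert m B \<times> insert m B"])
    show "F \<in> extensional (insert m B \<times> insert m B)"
      using bqn_opsD(1)[OF F] by (simp add: PiE_def)
    show "adjoin m B G \<in> extensional (insert m B \<times> insert m B)"
      by (simp add: adjoin_def)
    show "F p = adjoin m B G p" if "p \<in> insert m B \<times> insert m B" for p
      using that ann by (auto simp: annihilator_def adjoin_simps[OF assms(1)] G)
  qed
  ultimately show "F \<in> adjoin m B ` bqn_ops B" by blast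
qed

section \<open>Projections and the case distinction at the extreme pair\<close>

lemma projections_in_bqn_ops:
  "restrict fst (A \<times> A) \<in> bqn_ops A" "restrict snd (A \<times> A) \<in> bqn_ops A"
  by (rule bqn_opsI; auto)+

lemma not_has_neutral_projection:
  assumes "a \<in> A" "b \<in> A" "a \<noteq> b"
  shows "\<not> has_neutral A (restrict fst (A \<times> A))" "\<not> has_neutral A (restrict snd (A \<times> A))"
proof -
  have "\<exists>x\<in>A. x \<noteq> e" for e
    using assms by metis
  then show "\<not> has_neutral A (restrict fst (A \<times> A))" "\<not> has_neutral A (restrict snd (A \<times> A))"
    unfolding has_neutral_def by fastforce+
qed

lemma bqn_ops_cases:
  assumes F: "F \<in> bqn_ops A" and mA: "m \<in> A" "M \<in> A" "m \<noteq> M"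
    and bounds: "\<And>x. x \<in> A \<Longrightarrow> m \<le> x \<and> x \<le> M"
  shows "annihilator A F m \<or> annihilator A F M \<or>
    F = restrict fst (A \<times> A) \<or> F = restrict snd (A \<times> A)"
proof -
  note closed = bqn_opsD(2)[OF F] and bisym = bqn_opsD(3)[OF F]
    and quasi = bqn_opsD(4)[OF F] and mono = bqn_opsD(5)[OF F]
  have idem: "F (x, x) = x" if "x \<in> A" for x
    using quasi[of x x] that by auto
  \<comment> \<open>The first two bounds push row and column \<open>m\<close> down to
    \<open>m\<close> when both corner values are \<open>m\<close>; the last two push row and column
    \<open>M\<close> up to \<open>M\<close> when both are \<open>M\<close>.\<close>
  have between: "F (m, x) \<le> F (m, M)" "F (x, m) \<le> F (M, m)"
    "F (m, M) \<le> F (x, M)" "F (M, m) \<le> F (M, x)" if "x \<in> A" for x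
    using that mA bounds by (auto intro!: mono)
  have ext: "F = restrict f (A \<times> A)"
    if "\<And>x y. x \<in> A \<Longrightarrow> y \<in> A \<Longrightarrow> F (x, y) = f (x, y)" for f
    by (rule extensionalityI[where A = "A \<times> A"])
      (use that bqn_opsD(1)[OF F] in \<open>auto simp: PiE_def\<close>)
  consider (least) "F (m, M) = m" "F (M, m) = m" | (greatest) "F (m, M) = M" "F (M, m) = M"
    | (left) "F (m, M) = m" "F (M, m) = M" | (right) "F (m, M) = M" "F (M, m) = m"
    using quasi[OF mA(1,2)] quasi[OF mA(2,1)] by blast
  then show ?thesis
  proof cases
    case least
    then have "annihilator A F m"
      unfolding annihilator_def using between(1,2) bounds closed mA by (auto intro!: order_antisym)
    then show ?thesis by blast
  next
    case greatest
    then have "annihilator A F M"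
      unfolding annihilator_def using between(3,4) bounds closed mA by (auto intro!: order_antisym)
    then show ?thesis by blast
  next
    case left
    have "F (x, m) = x \<and> F (x, M) = x" if x: "x \<in> A" for x
    proof -
      \<comment> \<open>By quasitriviality \<open>F (x, m)\<close> is \<open>x\<close> or
        \<open>m\<close>, and \<open>F (x, M)\<close> is \<open>x\<close> or \<open>M\<close>. The
        first two identities settle the mixed cases; the third excludes the pair \<open>m\<close>,
        \<open>M\<close>, which would give \<open>F (m, M) = F (M, m)\<close>.\<close>
      have "F (F (x, m), F (x, M)) = F (x, m)" "F (F (x, M), F (x, m)) = F (x, M)"
        "F (F (x, m), M) = F (F (x, M), m)"
        using bisym[of x x m M] bisym[of x x M m] bisym[of x m M m] idem left x mA by simp_all
      then show ?thesis
        using quasi[OF x mA(1)] quasi[OF x mA(2)] left \<open>m \<noteq> M\<close> by auto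
    qed
    \<comment> \<open>Squeeze:
      \<open>x = F (x, m) \<le> F (x, y) \<le> F (x, M) = x\<close>.\<close>
    then have "F (x, y) = x" if "x \<in> A" "y \<in> A" for x y
      using mono[of x m x y] mono[of x y x M] that mA bounds by (simp add: order_antisym)
    then show ?thesis using ext[of fst] by simp
  next
    case right
    \<comment> \<open>This is the previous case for the opposite operation, with the arguments of
      \<open>F\<close> exchanged.\<close>
    have "F (m, x) = x \<and> F (M, x) = x" if x: "x \<in> A" for x
    proof -
      have "F (F (m, x), F (M, x)) = F (M, x)" "F (F (M, x), F (m, x)) = F (m, x)"
        "F (M, F (m, x)) = F (m, F (M, x))"
        using bisym[of m M x x] bisym[of M m x x] bisym[of m M m x] idem right x mA by simp_all
      then show ?thesis
        using quasi[OF mA(1) x] quasi[OF mA(2) x] right \<open>m \<noteq> M\<close> by auto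
    qed
    then have "F (x, y) = y" if "x \<in> A" "y \<in> A" for x y
      using mono[of m y x y] mono[of x y M y] that mA bounds by (simp add: order_antisym)
    then show ?thesis using ext[of snd] by simp
  qed
qed

section \<open>Counting by induction on the size of the chain\<close>

text \<open>Closed form of the two recurrences, both starting at 1 on a one-point chain. The chain
  stays arbitrary because the induction hypothesis is applied to \<open>A - {m}\<close> and to
  \<open>A - {M}\<close>.\<close>

lemma card_bqn_ops:
  fixes A :: "'a::linorder set"
  assumes "card A = Suc n"
  shows "card (bqn_ops A) = 3 * 2 ^ n - 2 \<and> card {F \<in> bqn_ops A. has_neutral A F} = 2 ^ n"
  using assms
proof (induction n arbitrary: A)
  case 0
  then obtain a where A: "A = {a}"
    by (auto simp: card_Suc_eq)
  have "bqn_ops A = {restrict fst (A \<times> A)}"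
  proof (intro equalityI subsetI)
    fix F assume F: "F \<in> bqn_ops A"
    have "F = restrict fst (A \<times> A)"
      by (rule extensionalityI[where A = "A \<times> A"])
        (use bqn_opsD(1)[OF F] in \<open>auto simp: A PiE_def\<close>)
    then show "F \<in> {restrict fst (A \<times> A)}" by simp
  qed (use projections_in_bqn_ops in auto)
  moreover have "has_neutral A (restrict fst (A \<times> A))"
    by (simp add: has_neutral_def A)
  ultimately have "bqn_ops A = {restrict fst (A \<times> A)}"
    and "{F \<in> bqn_ops A. has_neutral A F} = {restrict fst (A \<times> A)}"
    by auto
  then show ?case by simp
next
  case (Suc n)
  have fin: "finite A" using Suc.prems by (metis card.infinite nat.simps(3))
  have "A \<noteq> {}" using Suc.prems by auto
  define m M where "m = Min A" and "M = Max A"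
  have mA: "m \<in> A" "M \<in> A" and bounds: "\<And>x. x \<in> A \<Longrightarrow> m \<le> x \<and> x \<le> M"
    using fin \<open>A \<noteq> {}\<close> by (auto simp: m_def M_def)
  have "m \<noteq> M"
  proof
    assume "m = M"
    then have "A \<subseteq> {m}" using bounds by (auto intro: order_antisym)
    then have "card A \<le> card {m}" by (intro card_mono) auto
    then show False using Suc.prems by simp
  qed
  define N where "N = {F. has_neutral A F}"
  define Z where "Z e = {F \<in> bqn_ops A. annihilator A F e}" for e
  have Z: "card (Z e) = 3 * 2 ^ n - 2 \<and> card (Z e \<inter> N) = 2 ^ n" if e: "e = m \<or> e = M" for e
  proof -
    define B where "B = A - {e}"
    have "e \<in> A" using e mA by auto
    then have insert: "insert e B = A" and "e \<notin> B" and cardB: "card B = Suc n"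
      using Suc.prems fin by (auto simp: B_def)
    have "B \<noteq> {}" using cardB by auto
    have extreme: "(\<forall>x\<in>B. e < x) \<or> (\<forall>x\<in>B. x < e)"
      using e bounds unfolding B_def by force
    have image: "Z e = adjoin e B ` bqn_ops B"
      using adjoin_image[OF \<open>e \<notin> B\<close> extreme] by (simp add: insert Z_def)
    have image': "Z e \<inter> N = adjoin e B ` {G \<in> bqn_ops B. has_neutral B G}"
      using has_neutral_adjoin[OF \<open>e \<notin> B\<close> \<open>B \<noteq> {}\<close>] by (auto simp: image N_def insert)
    note inj = inj_on_adjoin[OF \<open>e \<notin> B\<close>]
    have "inj_on (adjoin e B) {G \<in> bqn_ops B. has_neutral B G}"
      by (rule inj_on_subset[OF inj]) auto
    then have "card (Z e \<inter> N) = 2 ^ n"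
      unfolding image' using Suc.IH[OF cardB] by (simp add: card_image)
    moreover have "card (Z e) = 3 * 2 ^ n - 2"
      unfolding image using Suc.IH[OF cardB] inj by (simp add: card_image)
    ultimately show ?thesis by blast
  qed
  define P where "P = {restrict fst (A \<times> A), restrict snd (A \<times> A)}"
  \<comment> \<open>The summand 2 of the recurrence: the projections differ as soon as the chain has
    two elements.\<close>
  have "restrict fst (A \<times> A) (m, M) \<noteq> restrict snd (A \<times> A) (m, M)"
    using mA \<open>m \<noteq> M\<close> by simp
  then have cardP: "card P = 2"
    unfolding P_def by (metis card_2_iff)
  \<comment> \<open>Two annihilators would force \<open>F (m, M)\<close> to equal both
    \<open>m\<close> and \<open>M\<close>.\<close>
  have disj: "Z m \<inter> Z M = {}"
    using mA \<open>m \<noteq> M\<close> by (force simp: Z_def annihilator_def)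
  \<comment> \<open>For \<open>b \<noteq> e\<close>, the first projection sends
    \<open>(b, e)\<close> to \<open>b\<close>, and the second sends \<open>(e, b)\<close> to
    \<open>b\<close>.\<close>
  have "F \<notin> Z e" if "F \<in> P" "e \<in> A" for F e
  proof -
    obtain b where "b \<in> A" "b \<noteq> e" using mA \<open>m \<noteq> M\<close> by metis
    then show ?thesis using that by (auto simp: P_def Z_def annihilator_def)
  qed
  then have disjP: "P \<inter> (Z m \<union> Z M) = {}"
    using mA by blast
  have PN: "P \<inter> N = {}"
    using not_has_neutral_projection[OF mA \<open>m \<noteq> M\<close>] by (auto simp: P_def N_def)
  have split: "bqn_ops A = P \<union> (Z m \<union> Z M)"
    using bqn_ops_cases[OF _ mA \<open>m \<noteq> M\<close> bounds] projections_in_bqn_ops[of A]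
    by (auto simp: P_def Z_def)
  have finZ: "finite (Z e)" for e
    using finite_bqn_ops[OF fin] by (simp add: Z_def)
  have "card (bqn_ops A) = card P + (card (Z m) + card (Z M))"
  proof -
    have "finite P" by (simp add: P_def)
    then show ?thesis
      unfolding split using disj disjP finZ by (subst card_Un_disjoint) (auto simp: card_Un_disjoint)
  qed
  moreover have "{F \<in> bqn_ops A. has_neutral A F} = (Z m \<inter> N) \<union> (Z M \<inter> N)"
    using PN split by (auto simp: N_def)
  moreover have "card ((Z m \<inter> N) \<union> (Z M \<inter> N)) = card (Z m \<inter> N) + card (Z M \<inter> N)"
    using disj finZ by (intro card_Un_disjoint) auto
  \<comment> \<open>Subtraction on \<open>nat\<close> truncates; \<open>1 \<le> 2 ^ n\<close>
    ensures that it does not do so here.\<close>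
  moreover have "2 + ((3 * 2 ^ n - 2) + (3 * 2 ^ n - 2)) = 3 * 2 ^ Suc n - (2::nat)"
    using one_le_power[of "2::nat" n] unfolding power_Suc by linarith
  ultimately show ?case
    using Z[of m] Z[of M] cardP by simp
qed

section \<open>Transfer to the chain \<open>L k\<close>\<close>

theorem proposition6p5:
  fixes k :: nat
  assumes "k \<ge> 1"
  shows "D k = 2 ^ (k - 1) \<and> C k = 3 * 2 ^ (k - 1) - 2"
proof -
  have ops: "{F \<in> binary_ops k. bisymmetric k F \<and> quasitrivial k F \<and> nondecreasing k F}
      = bqn_ops (L k)"
    by (simp add: bqn_ops_def binary_ops_def bisymmetric_def quasitrivial_def nondecreasing_def)
  have "(\<exists>e. neutral_element k F e) \<longleftrightarrow> has_neutral (L k) F" for F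
    by (auto simp: neutral_element_def has_neutral_def)
  then have "{F \<in> binary_ops k. bisymmetric k F \<and> quasitrivial k F \<and> nondecreasing k F \<and>
      (\<exists>e. neutral_element k F e)} = {F \<in> bqn_ops (L k). has_neutral (L k) F}"
    unfolding ops[symmetric] by auto
  \<comment> \<open>Here \<open>k \<ge> 1\<close> matters: for \<open>k = 0\<close> the right side
    would be 1, while \<open>L 0\<close> is empty.\<close>
  moreover have "card (L k) = Suc (k - 1)"
    using assms by (simp add: L_def)
  ultimately show ?thesis
    using card_bqn_ops[of "L k" "k - 1"] ops by (simp add: C_def D_def)
qed

end
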